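(* Let $K_0:(0,\infty)\to\mathbb R$ be a $C^\infty$ function such that $-K_0'$ is a nontrivial completely monotone function, with Bernstein representation $$-K_0'(t)=\int_0^\infty e^{-tx}\,d\mu(x),\qquad t>0,$$ where $\mu$ is a non-negative Radon measure on $[0,\infty)$, and such that $\int_0^1|K_0(t)|\,t^{-\alpha}\,dt<\infty$ for some $\alpha\in(0,1)$. For $n\ge1$ let $$\lambda_n=\int_0^{2\pi}K_0\!\left(2\left|\sin\tfrac{\eta}{2}\right|\right)\cos(n\eta)\,d\eta .$$ Then for every $n\ge 1$, $$\lambda_n=2\int_0^\infty\frac{\phi_n(x)}{x}\,d\mu(x),\qquad \phi_n(x):=\int_0^\pi e^{-2x\sin\eta}e^{2in\eta}\,d\eta=\int_0^\pi e^{-2x\sin\eta}\cos(2n\eta)\,d\eta .$$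
   Context: A $C^\infty$ function $g:(0,\infty)\to\mathbb R$ is completely monotone if $(-1)^kg^{(k)}(t)\ge0$ for all $t>0$ and all integers $k\ge0$. One has $\phi_n\in C^\infty(\mathbb R)$ and $\phi_n(0)=0$; the quotient $\phi_n(x)/x$ is understood at $x=0$ through its continuous extension (removable singularity), and $\int_0^\infty$ with respect to $\mu$ means integration over $[0,\infty)$. *)

theory Defs
  imports "HOL-Analysis.Analysis"
begin

text \<open>
  A function on \<open>(0,\<infinity>)\<close> is a total function \<open>real \<Rightarrow> real\<close>; its values outside \<open>(0,\<infinity>)\<close> play no
  role, as \<open>{0<..}\<close> is open and all integrals below range over open intervals.
\<close>

definition smooth_on_pos :: "(real \<Rightarrow> real) \<Rightarrow> bool" where
  "smooth_on_pos g \<longleftrightarrow> (\<forall>k. \<forall>t>0. (deriv ^^ k) g differentiable (at t))"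

definition completely_monotone :: "(real \<Rightarrow> real) \<Rightarrow> bool" where
  "completely_monotone g \<longleftrightarrow>
     smooth_on_pos g \<and> (\<forall>k. \<forall>t>0. (-1) ^ k * (deriv ^^ k) g t \<ge> 0)"

text \<open>
  Radon measures on a subspace \<open>X\<close>: Borel measures that are finite on compact sets and inner
  regular. Such a measure lives on \<open>space M = X\<close>, so that an integral \<open>LINT x|M. f x\<close> is an
  integral over \<open>X\<close>.
\<close>

definition radon_measure_on :: "'a::t2_space set \<Rightarrow> 'a measure \<Rightarrow> bool" where
  "radon_measure_on X M \<longleftrightarrow>
     sets M = sets (restrict_space borel X) \<and>
     (\<forall>K. compact K \<and> K \<subseteq> X \<longrightarrow> emeasure M K < \<infinity>) \<and>
     (\<forall>A\<in>sets M. emeasure M A = (SUP K\<in>{K. compact K \<and> K \<subseteq> A}. emeasure M K))"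

definition lambda_integrand :: "(real \<Rightarrow> real) \<Rightarrow> nat \<Rightarrow> real \<Rightarrow> real" where
  "lambda_integrand K0 n \<eta> = K0 (2 * \<bar>sin (\<eta> / 2)\<bar>) * cos (real n * \<eta>)"

definition lambda_coeff :: "(real \<Rightarrow> real) \<Rightarrow> nat \<Rightarrow> real" where
  "lambda_coeff K0 n = (LBINT \<eta>=ereal 0..ereal (2 * pi). lambda_integrand K0 n \<eta>)"

definition phi :: "nat \<Rightarrow> real \<Rightarrow> complex" where
  "phi n x = (LBINT \<eta>=ereal 0..ereal pi.
     complex_of_real (exp (- 2 * x * sin \<eta>)) * exp (2 * \<i> * of_nat n * complex_of_real \<eta>))"

text \<open>
  The quotient \<open>\<phi>\<^sub>n(x)/x\<close>, extended continuously to \<open>x = 0\<close>. The limit exists for \<open>n \<ge> 1\<close>, see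
  \<open>isCont_phi_quot_0\<close> below.
\<close>

definition phi_quot :: "nat \<Rightarrow> real \<Rightarrow> complex" where
  "phi_quot n x =
     (if x = 0 then Lim (at 0) (\<lambda>y. phi n y / complex_of_real y) else phi n x / complex_of_real x)"

lemma phi_eq_integral:
  "phi n x = integral {0..pi}
     (\<lambda>\<eta>. complex_of_real (exp (- 2 * x * sin \<eta>)) * exp (2 * \<i> * of_nat n * complex_of_real \<eta>))"
  unfolding phi_def
  by (intro interval_integral_eq_integral borel_integrable_atLeastAtMost' continuous_intros) auto

lemma phi_0:
  assumes "n \<ge> 1"
  shows "phi n 0 = 0"
proof -
  define c where "c = 2 * \<i> * complex_of_nat n"
  have c: "c \<noteq> 0" using assms by (simp add: c_def)
  have "((\<lambda>\<eta>. exp (c * complex_of_real \<eta>)) has_integral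
      (exp (c * complex_of_real pi) / c - exp (c * complex_of_real 0) / c)) {0..pi}"
  proof (rule fundamental_theorem_of_calculus)
    fix x :: real
    have "((\<lambda>z. exp (c * z) / c) has_field_derivative exp (c * complex_of_real x))
        (at (complex_of_real x))"
      using c by (auto intro!: derivative_eq_intros)
    then show "((\<lambda>\<eta>. exp (c * complex_of_real \<eta>) / c) has_vector_derivative
        exp (c * complex_of_real x)) (at x within {0..pi})"
      using has_vector_derivative_real_field has_vector_derivative_at_within by blast
  qed auto
  moreover have "exp (c * complex_of_real pi) = 1"
    using exp_integer_2pi[of "of_nat n"] by (simp add: c_def mult_ac)
  ultimately have "integral {0..pi} (\<lambda>\<eta>. exp (c * complex_of_real \<eta>)) = 0"
    by (simp add: integral_unique)
  then show ?thesis by (simp add: phi_eq_integral c_def)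
qed

lemma phi_has_vector_derivative:
  "(phi n has_vector_derivative integral {0..pi} (\<lambda>\<eta>.
      complex_of_real (- 2 * sin \<eta> * exp (- 2 * x * sin \<eta>)) *
        exp (2 * \<i> * of_nat n * complex_of_real \<eta>))) (at x)"
proof -
  have "((\<lambda>x. integral (cbox 0 pi) (\<lambda>\<eta>. complex_of_real (exp (- 2 * x * sin \<eta>)) *
        exp (2 * \<i> * of_nat n * complex_of_real \<eta>))) has_vector_derivative
      integral (cbox 0 pi) (\<lambda>\<eta>. complex_of_real (- 2 * sin \<eta> * exp (- 2 * x * sin \<eta>)) *
        exp (2 * \<i> * of_nat n * complex_of_real \<eta>))) (at x within UNIV)"
  proof (rule leibniz_rule_vector_derivative)
    fix x t :: real
    show "((\<lambda>x. complex_of_real (exp (- 2 * x * sin t)) *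
        exp (2 * \<i> * of_nat n * complex_of_real t)) has_vector_derivative
        complex_of_real (- 2 * sin t * exp (- 2 * x * sin t)) *
        exp (2 * \<i> * of_nat n * complex_of_real t)) (at x within UNIV)"
      by (intro has_vector_derivative_mult_left has_vector_derivative_of_real)
         (auto intro!: derivative_eq_intros)
  next
    fix x :: real
    show "(\<lambda>\<eta>. complex_of_real (exp (- 2 * x * sin \<eta>)) *
        exp (2 * \<i> * of_nat n * complex_of_real \<eta>)) integrable_on cbox 0 pi"
      by (intro integrable_continuous continuous_intros)
  qed (auto simp: split_beta intro!: continuous_intros)
  then show ?thesis by (simp add: phi_eq_integral[abs_def])
qed

lemma isCont_phi_quot_0:
  assumes "n \<ge> 1"
  shows "isCont (phi_quot n) 0"
proof -
  from phi_has_vector_derivative[of n 0] obtain D where "(phi n has_vector_derivative D) (at 0)"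
    by blast
  then have "((\<lambda>y. norm (phi n y - phi n 0 - y *\<^sub>R D) / norm y) \<longlongrightarrow> 0) (at 0)"
    by (simp add: has_vector_derivative_def has_derivative_iff_norm)
  moreover have "norm (phi n y - phi n 0 - y *\<^sub>R D) / norm y
      = norm (phi n y / complex_of_real y - D)" if "y \<noteq> 0" for y
  proof -
    have "phi n y / complex_of_real y - D = (phi n y - phi n 0 - y *\<^sub>R D) / complex_of_real y"
      using that phi_0[OF assms] by (simp add: scaleR_conv_of_real field_simps)
    then show ?thesis by (simp add: norm_divide)
  qed
  ultimately have "((\<lambda>y. norm (phi n y / complex_of_real y - D)) \<longlongrightarrow> 0) (at 0)"
    by (auto elim!: Lim_transform_eventually simp: eventually_at_filter)
  then have lim: "((\<lambda>y. phi n y / complex_of_real y) \<longlongrightarrow> D) (at 0)"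
    using LIM_zero_cancel tendsto_norm_zero_iff by blast
  then have "phi_quot n 0 = D"
    by (simp add: phi_quot_def tendsto_Lim)
  moreover have "(phi_quot n \<longlongrightarrow> D) (at 0)"
    using lim by (rule Lim_transform_eventually) (auto simp: eventually_at_filter phi_quot_def)
  ultimately show ?thesis by (simp add: isCont_def)
qed

end

theory Submission
  imports Defs
begin

text \<open>
  For \<open>0 < t \<le> 2\<close>, integrating the Bernstein representation over \<open>[t, 2]\<close> gives
  \<open>K0 t - K0 2 = \<integral>exp_quot x t d\<mu>\<close> by Tonelli. Subtracting the constant \<open>K0 2\<close> does not change
  \<open>\<lambda>\<^sub>n\<close> for \<open>n \<ge> 1\<close> and makes the integrand \<open>exp_quot x (2 * sin u)\<close> non-negative, so Fubini
  applies once \<open>K0 (2 * sin u)\<close> is integrable on \<open>(0,\<pi>)\<close>; this follows from monotonicity and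
  \<open>2 * sin u \<ge> min u (\<pi> - u)\<close>. The inner integral over \<open>u\<close> is then \<open>\<phi>\<^sub>n(x)/x\<close>.
\<close>

section \<open>The kernel obtained by integrating an exponential over a bounded interval\<close>

text \<open>Closed form of the integral of exp(-s x) over s in [t, 2], for t \<le> 2. The case
  \<open>x = 0\<close> is separate because division by zero would give 0 there instead of 2 - t, and
  \<mu> may have an atom at 0.\<close>

definition exp_quot :: "real \<Rightarrow> real \<Rightarrow> real" where
  "exp_quot x t = (if x = 0 then 2 - t else (exp (- t * x) - exp (- 2 * x)) / x)"

lemma measurable_exp_quot [measurable]:
  assumes [measurable]: "f \<in> borel_measurable M" "g \<in> borel_measurable M"
  shows "(\<lambda>z. exp_quot (f z) (g z)) \<in> borel_measurable M"
  unfolding exp_quot_def by measurable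

text \<open>Phrased with the non-negative integral so that Tonelli can exchange it with the integral
  over \<mu> before any integrability is known.\<close>

lemma nn_integral_exp_Icc:
  assumes "t \<le> 2"
  shows "(\<integral>\<^sup>+s. ennreal (exp (- s * x)) * indicator {t..2} s \<partial>lborel) = ennreal (exp_quot x t)"
proof (cases "x = 0")
  case True
  then show ?thesis using assms by (simp add: exp_quot_def)
next
  case False
  define F where "F = (\<lambda>s::real. - exp (- s * x) / x)"
  have "(\<integral>\<^sup>+s. ennreal (exp (- s * x)) * indicator {t..2} s \<partial>lborel) = ennreal (F 2 - F t)"
  proof (rule nn_integral_FTC_Icc)
    fix s :: real
    show "(F has_real_derivative exp (- s * x)) (at s)"
      unfolding F_def using False by (auto intro!: derivative_eq_intros)
  qed (use assms in auto)
  also have "F 2 - F t = exp_quot x t"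
    using False by (simp add: F_def exp_quot_def diff_divide_distrib)
  finally show ?thesis .
qed

text \<open>For \<open>x < 0\<close> numerator and denominator are both non-positive, so the sign is
  right for every real x and not only on the space of \<mu>.\<close>

lemma exp_quot_nonneg:
  assumes "t \<le> 2"
  shows "exp_quot x t \<ge> 0"
proof (cases "x > 0")
  case True
  with assms show ?thesis by (auto simp: exp_quot_def)
next
  case False
  with assms show ?thesis
    by (auto simp: exp_quot_def divide_nonpos_neg mult_right_mono_neg)
qed

section \<open>A lower bound for the sine and sigma-finiteness on the half-line\<close>

text \<open>The function 2 sin u - u is concave on [0, \<pi>/2], hence lies above its chord, which
  runs from 0 to 2 - \<pi>/2 > 0.\<close>

lemma sin_ge_half:
  fixes u :: real
  assumes "0 \<le> u" "u \<le> pi / 2"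
  shows "u \<le> 2 * sin u"
proof -
  define f where "f = (\<lambda>u::real. 2 * sin u - u)"
  have "concave_on {0..pi/2} f"
    unfolding concave_on_def
  proof (rule f''_ge0_imp_convex)
    fix x :: real assume "x \<in> {0..pi/2}"
    then show "2 * sin x \<ge> 0" by (auto intro!: sin_ge_zero)
    show "((\<lambda>x. - f x) has_real_derivative 1 - 2 * cos x) (at x)"
      unfolding f_def by (auto intro!: derivative_eq_intros)
    show "((\<lambda>x. 1 - 2 * cos x) has_real_derivative 2 * sin x) (at x)"
      by (auto intro!: derivative_eq_intros)
  qed auto
  from concave_onD_Icc'[OF this, of u] assms pi_less_4
  have "(2 - pi / 2) / (pi / 2) * u \<le> f u" "0 \<le> (2 - pi / 2) / (pi / 2) * u"
    by (simp_all add: f_def)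
  then have "f u \<ge> 0" by linarith
  then show ?thesis by (simp add: f_def)
qed

text \<open>The compact intervals [0, k] have finite measure and exhaust the half-line. Product
  measures with \<open>lborel\<close> rely on this.\<close>

lemma sigma_finite_radon_measure_on_Ici:
  fixes \<mu> :: "real measure"
  assumes "radon_measure_on {0..} \<mu>"
  shows "sigma_finite_measure \<mu>"
proof
  have sets: "sets \<mu> = sets (restrict_space borel {0..})"
    and fin: "compact K \<Longrightarrow> K \<subseteq> {0..} \<Longrightarrow> emeasure \<mu> K < \<infinity>" for K
    using assms by (auto simp: radon_measure_on_def)
  have space: "space \<mu> = {0..}"
    using sets_eq_imp_space_eq[OF sets] by (simp add: space_restrict_space)
  let ?A = "range (\<lambda>k::nat. {0..real k})"
  have "{0..real k} \<in> sets \<mu>" for k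
    unfolding sets by (auto simp: sets_restrict_space_iff)
  moreover have "\<Union>?A = space \<mu>"
    using real_arch_simple by (auto simp: space)
  moreover have "\<forall>a\<in>?A. emeasure \<mu> a \<noteq> \<infinity>"
    using fin[OF compact_Icc] by (auto simp: less_top[symmetric] top_unique)
  ultimately show "\<exists>A. countable A \<and> A \<subseteq> sets \<mu> \<and> \<Union>A = space \<mu> \<and> (\<forall>a\<in>A. emeasure \<mu> a \<noteq> \<infinity>)"
    by (intro exI[of _ ?A]) auto
qed

section \<open>Cosine integrals for \<open>phi\<close> and \<open>phi_quot\<close>\<close>

text \<open>The substitution u -> \<pi> - u maps the interval onto itself with Jacobian 1; it is
  carried out on the integrand times its indicator over the whole line.\<close>

lemma integral_reflect_pi:
  fixes f :: "real \<Rightarrow> real"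
  assumes "continuous_on {0..pi} f"
  shows "integral {0..pi} (\<lambda>u. f (pi - u)) = integral {0..pi} f"
proof -
  have int: "set_integrable lborel {0..pi} f"
    by (intro borel_integrable_atLeastAtMost' assms)
  have "set_integrable lborel {0..pi} (\<lambda>u. f (pi - u))"
    by (intro borel_integrable_atLeastAtMost' continuous_on_compose2[OF assms] continuous_intros) auto
  then have "integral {0..pi} (\<lambda>u. f (pi - u)) = (LINT u:{0..pi}|lborel. f (pi - u))"
    by (simp add: set_borel_integral_eq_integral)
  also have "\<dots> = (\<integral>u. indicator {0..pi} (pi + (-1) * u) *\<^sub>R f (pi + (-1) * u) \<partial>lborel)"
    unfolding set_lebesgue_integral_def
    by (intro Bochner_Integration.integral_cong) (auto simp: indicator_def)
  also have "\<dots> = (LINT u:{0..pi}|lborel. f u)"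
    unfolding set_lebesgue_integral_def by (subst (2) lborel_integral_real_affine[of "-1" _ pi]) auto
  also have "\<dots> = integral {0..pi} f"
    using int by (simp add: set_borel_integral_eq_integral)
  finally show ?thesis .
qed

text \<open>The imaginary part f(u) sin(2nu) changes sign under u -> \<pi> - u, so its integral
  vanishes. Used both for \<open>phi\<close> and for its derivative at 0.\<close>

lemma integral_symmetric_times_exp:
  fixes f :: "real \<Rightarrow> real"
  assumes cont: "continuous_on {0..pi} f" and sym: "\<And>u. f (pi - u) = f u"
  shows "integral {0..pi} (\<lambda>u. complex_of_real (f u) * exp (2 * \<i> * of_nat n * complex_of_real u))
    = complex_of_real (integral {0..pi} (\<lambda>u. f u * cos (2 * real n * u)))"
proof -
  let ?g = "\<lambda>u. complex_of_real (f u) * exp (2 * \<i> * of_nat n * complex_of_real u)"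
  let ?c = "\<lambda>u. f u * cos (2 * real n * u)" and ?s = "\<lambda>u. f u * sin (2 * real n * u)"
  have g: "?g u = complex_of_real (?c u) + \<i> * complex_of_real (?s u)" for u
    by (simp add: exp_eq_polar complex_eq_iff)
  have int: "?c integrable_on {0..pi}" "?s integrable_on {0..pi}"
    by (intro integrable_continuous_real continuous_intros cont)+
  have "?s (pi - u) = - ?s u" for u
  proof -
    have "2 * real n * (pi - u) = 2 * pi * real n - 2 * real n * u"
      by (simp add: algebra_simps)
    moreover have "sin (2 * pi * real n) = 0" "cos (2 * pi * real n) = 1"
      using sin_2npi[of n] cos_2npi[of n] by (simp_all add: mult_ac)
    ultimately show ?thesis by (simp add: sym sin_diff)
  qed
  then have "- integral {0..pi} ?s = integral {0..pi} ?s"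
    using integral_reflect_pi[of ?s] by (simp add: continuous_on_mult cont continuous_on_sin)
  then have s: "integral {0..pi} ?s = 0" by simp
  have "(?g has_integral (complex_of_real (integral {0..pi} ?c)
      + \<i> * complex_of_real (integral {0..pi} ?s))) {0..pi}"
    unfolding g by (intro has_integral_add has_integral_mult_right has_integral_of_real
        integrable_integral int)
  then show ?thesis unfolding s by (simp add: integral_unique)
qed

lemma phi_eq_cos_integral:
  "phi n x = complex_of_real (integral {0..pi} (\<lambda>u. exp (- 2 * x * sin u) * cos (2 * real n * u)))"
  unfolding phi_eq_integral
  by (rule integral_symmetric_times_exp) (auto intro!: continuous_intros)

text \<open>Since \<open>phi n 0 = 0\<close>, the limit of the quotient is the derivative of
  \<open>phi n\<close> at 0, which is known from differentiation under the integral sign.\<close>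

lemma phi_quot_0:
  assumes "n \<ge> 1"
  shows "phi_quot n 0 = complex_of_real (integral {0..pi} (\<lambda>u. - 2 * sin u * cos (2 * real n * u)))"
proof -
  define d where "d = integral {0..pi} (\<lambda>u. - 2 * sin u * cos (2 * real n * u))"
  have "integral {0..pi} (\<lambda>u. complex_of_real (- 2 * sin u * exp (- 2 * 0 * sin u)) *
      exp (2 * \<i> * of_nat n * complex_of_real u)) = complex_of_real d"
    unfolding d_def by (subst integral_symmetric_times_exp) (auto intro!: continuous_intros)
  with phi_has_vector_derivative[of n 0] have "(phi n has_vector_derivative complex_of_real d) (at 0)"
    by simp
  \<comment> \<open>\<open>phi\<close> is real-valued, so its real part carries the whole difference
    quotient and the real derivative suffices.\<close>
  from bounded_linear.has_vector_derivative[OF bounded_linear_Re this]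
  have "((\<lambda>y. Re (phi n y) / y) \<longlongrightarrow> d) (at 0)"
    by (simp add: phi_0[OF assms] has_field_derivative_iff
        flip: has_real_derivative_iff_has_vector_derivative)
  then have "((\<lambda>y. complex_of_real (Re (phi n y) / y)) \<longlongrightarrow> complex_of_real d) (at 0)"
    by (rule tendsto_of_real)
  then have "((\<lambda>y. phi n y / complex_of_real y) \<longlongrightarrow> complex_of_real d) (at 0)"
    by (simp add: phi_eq_cos_integral)
  then show ?thesis
    by (simp add: phi_quot_def d_def tendsto_Lim)
qed

text \<open>This is \<open>phi_0\<close> read at weight exp(0) = 1. It makes terms constant in u
  disappear for n \<ge> 1.\<close>

lemma has_integral_cos_double:
  assumes "n \<ge> 1"
  shows "((\<lambda>u. cos (2 * real n * u)) has_integral 0) {0..pi}"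
proof -
  have "integral {0..pi} (\<lambda>u. cos (2 * real n * u)) = 0"
    using phi_0[OF assms] by (simp add: phi_eq_cos_integral)
  moreover have "(\<lambda>u. cos (2 * real n * u)) integrable_on {0..pi}"
    by (intro integrable_continuous_real continuous_intros)
  ultimately show ?thesis by (simp add: has_integral_iff)
qed

text \<open>As functions of u, the kernel and exp(-2x sin u)/x differ by the constant exp(-2x)/x,
  which integrates to 0 against cos(2nu). At \<open>x = 0\<close> the constant is 2, added to -2 sin
  u.\<close>

lemma phi_quot_eq_integral:
  assumes "n \<ge> 1"
  shows "phi_quot n x =
    complex_of_real (integral {0..pi} (\<lambda>u. exp_quot x (2 * sin u) * cos (2 * real n * u)))"
proof (cases "x = 0")
  case True
  have c: "((\<lambda>u. 2 * cos (2 * real n * u)) has_integral 2 * 0) {0..pi}"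
    by (intro has_integral_mult_right has_integral_cos_double assms)
  have "((\<lambda>u. - 2 * sin u * cos (2 * real n * u)) has_integral
      integral {0..pi} (\<lambda>u. - 2 * sin u * cos (2 * real n * u))) {0..pi}"
    by (intro integrable_integral integrable_continuous_real continuous_intros)
  from integral_unique[OF has_integral_add[OF c this]]
  have "integral {0..pi} (\<lambda>u. (2 - 2 * sin u) * cos (2 * real n * u))
      = integral {0..pi} (\<lambda>u. - 2 * sin u * cos (2 * real n * u))"
    by (simp add: left_diff_distrib)
  with True show ?thesis
    by (simp add: phi_quot_0[OF assms] exp_quot_def)
next
  case False
  let ?f = "\<lambda>u. exp (- 2 * x * sin u) * cos (2 * real n * u)"
  have c: "((\<lambda>u. exp (- 2 * x) / x * cos (2 * real n * u)) has_integral exp (- 2 * x) / x * 0) {0..pi}"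
    by (intro has_integral_mult_right has_integral_cos_double assms)
  have "((\<lambda>u. 1 / x * ?f u) has_integral 1 / x * integral {0..pi} ?f) {0..pi}"
    by (intro has_integral_mult_right integrable_integral integrable_continuous_real continuous_intros)
  note integral_unique[OF has_integral_diff[OF this c]]
  moreover have "1 / x * ?f u - exp (- 2 * x) / x * cos (2 * real n * u)
      = exp_quot x (2 * sin u) * cos (2 * real n * u)" for u
    using False by (simp add: exp_quot_def right_diff_distrib diff_divide_distrib mult_ac)
  ultimately show ?thesis
    using False by (simp add: phi_quot_def phi_eq_cos_integral)
qed

section \<open>Integral representation of differences of K0, and integrability after composing with
  the sine\<close>

lemma smooth_on_pos_has_real_derivative:
  assumes "smooth_on_pos f" "t > 0"
  shows "(f has_real_derivative deriv f t) (at t)"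
proof -
  have "(deriv ^^ 0) f differentiable (at t)"
    using assms unfolding smooth_on_pos_def by blast
  then show ?thesis by (simp add: DERIV_deriv_iff_real_differentiable)
qed

text \<open>Tonelli for exp(-s x) on \<mu> times [t, 2]: integrating over s first gives the kernel,
  integrating over x first gives -f', whose integral over [t, 2] is f t - f 2.\<close>

lemma has_bochner_integral_exp_quot:
  fixes \<mu> :: "real measure"
  assumes [measurable_cong]: "sets \<mu> = sets (restrict_space borel {0..})"
    and "sigma_finite_measure \<mu>"
    and deriv: "\<And>s. s > 0 \<Longrightarrow> (f has_real_derivative - g s) (at s)"
    and bernstein: "\<And>s. s > 0 \<Longrightarrow> has_bochner_integral \<mu> (\<lambda>x. exp (- s * x)) (g s)"
    and t: "0 < t" "t \<le> 2"
  shows "has_bochner_integral \<mu> (\<lambda>x. exp_quot x t) (f t - f 2)"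
proof (rule has_bochner_integral_nn_integral)
  interpret sigma_finite_measure \<mu> by fact
  interpret pair_sigma_finite \<mu> lborel ..
  have id [measurable]: "(\<lambda>x. x) \<in> borel_measurable \<mu>"
    by (simp add: measurable_cong_sets[OF assms(1) refl] measurable_restrict_space1)
  \<comment> \<open>\<open>g\<close> is constrained only for s > 0. \<open>G\<close> agrees with it
    there and is measurable and non-negative on all of the line, also where the integral takes its
    default value 0.\<close>
  define G where "G s = (LINT x|\<mu>. exp (- s * x))" for s
  have [measurable]: "G \<in> borel_measurable borel"
    unfolding G_def by measurable
  have G: "G s = g s" if "s > 0" for s
    using bernstein[OF that] by (simp add: G_def has_bochner_integral_integral_eq)
  have G_nn: "G s \<ge> 0" for s
    unfolding G_def by (intro Bochner_Integration.integral_nonneg) auto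
  have deriv': "((\<lambda>s. - f s) has_real_derivative G s) (at s)" if "s > 0" for s
    using DERIV_minus[OF deriv[OF that]] G[OF that] by simp
  have FTC: "(\<integral>\<^sup>+s. ennreal (G s) * indicator {t..2} s \<partial>lborel) = ennreal (- f 2 - - f t)"
    by (rule nn_integral_FTC_Icc) (use t deriv' G_nn in auto)
  show "(\<lambda>x. exp_quot x t) \<in> borel_measurable \<mu>" by measurable
  show "AE x in \<mu>. 0 \<le> exp_quot x t" using t by (simp add: exp_quot_nonneg)
  \<comment> \<open>An equation under \<open>ennreal\<close> does not show the sign of f t - f 2, as
    negative reals are sent to 0; monotonicity supplies it.\<close>
  have "- f t \<le> - f 2"
  proof (rule DERIV_nonneg_imp_nondecreasing[of t 2 "\<lambda>s. - f s"])
    fix s assume "t \<le> s"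
    with t deriv'[of s] G_nn[of s]
    show "\<exists>y. ((\<lambda>s. - f s) has_real_derivative y) (at s) \<and> 0 \<le> y" by auto
  qed (use t in simp)
  then show "0 \<le> f t - f 2" by simp
  have "(\<integral>\<^sup>+x. ennreal (exp_quot x t) \<partial>\<mu>)
      = (\<integral>\<^sup>+x. (\<integral>\<^sup>+s. ennreal (exp (- s * x)) * indicator {t..2} s \<partial>lborel) \<partial>\<mu>)"
    by (simp only: nn_integral_exp_Icc[OF t(2)])
  also have "\<dots> = (\<integral>\<^sup>+s. (\<integral>\<^sup>+x. ennreal (exp (- s * x)) * indicator {t..2} s \<partial>\<mu>) \<partial>lborel)"
    by (rule Fubini'[symmetric]) measurable
  also have "\<dots> = (\<integral>\<^sup>+s. ennreal (G s) * indicator {t..2} s \<partial>lborel)"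
  proof (rule nn_integral_cong)
    fix s :: real
    show "(\<integral>\<^sup>+x. ennreal (exp (- s * x)) * indicator {t..2} s \<partial>\<mu>) = ennreal (G s) * indicator {t..2} s"
    proof (cases "s \<in> {t..2}")
      case True
      with t bernstein[of s] show ?thesis
        by (simp add: G_def nn_integral_eq_integral has_bochner_integral_iff)
    qed simp
  qed
  also have "\<dots> = ennreal (f t - f 2)"
    using FTC by simp
  finally show "(\<integral>\<^sup>+x. ennreal (exp_quot x t) \<partial>\<mu>) = ennreal (f t - f 2)" .
qed

text \<open>On (0, \<pi>/2] the bound u \<le> 2 sin u and monotonicity give f(2 sin u) \<le> f(u);
  the other half of the interval follows by reflection.\<close>

lemma integrable_decreasing_comp_sin:
  fixes f :: "real \<Rightarrow> real"
  assumes cont: "continuous_on {0<..} f"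
    and anti: "\<And>s t. 0 < s \<Longrightarrow> s \<le> t \<Longrightarrow> f t \<le> f s"
    and int: "set_integrable lborel {0<..<1} f"
  shows "set_integrable lborel {0<..<pi} (\<lambda>u. f (2 * sin u))"
proof -
  \<comment> \<open>Subtracting f 2 makes \<open>g\<close> non-negative, so that \<open>g\<close>
    plus its reflection dominates on both halves. The cut-off 2 exceeds \<pi>/2, and 2 sin u never
    exceeds 2.\<close>
  define g where "g u = indicator {0<..<2} u *\<^sub>R (f u - f 2)" for u :: real
  have "set_integrable lborel {0<..<1} (\<lambda>u. f u - f 2)"
    by (intro set_integral_diff int) (simp add: set_integrable_def)
  moreover have "set_integrable lborel {1..2} (\<lambda>u. f u - f 2)"
    by (intro borel_integrable_atLeastAtMost' continuous_intros continuous_on_subset[OF cont]) auto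
  ultimately have "set_integrable lborel ({0<..<1} \<union> {1..2}) (\<lambda>u. f u - f 2)"
    by (intro set_integrable_Un) auto
  then have "set_integrable lborel {0<..<2} (\<lambda>u. f u - f 2)"
    by (rule set_integrable_subset) auto
  then have g: "integrable lborel g"
    by (simp add: set_integrable_def g_def[abs_def])
  have g': "integrable lborel (\<lambda>u. g (pi + (-1) * u))"
    by (rule lborel_integrable_real_affine[OF g]) simp
  have g_nn: "g u \<ge> 0" for u
    using anti[of u 2] by (auto simp: g_def indicator_def)
  have bound: "f (2 * sin u) - f 2 \<le> g u" if "0 < u" "u \<le> pi / 2" for u
    using that sin_ge_half[of u] anti[of u "2 * sin u"] pi_less_4 by (auto simp: g_def)
  have "integrable lborel (\<lambda>u. indicator {0<..<pi} u *\<^sub>R (f (2 * sin u) - f 2))"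
  proof (rule Bochner_Integration.integrable_bound[OF Bochner_Integration.integrable_add[OF g g']])
    have "continuous_on {0<..<pi} (\<lambda>u. f (2 * sin u) - f 2)"
      by (intro continuous_intros continuous_on_compose2[OF cont]) (auto intro: sin_gt_zero)
    then show "(\<lambda>u. indicator {0<..<pi} u *\<^sub>R (f (2 * sin u) - f 2)) \<in> borel_measurable lborel"
      using borel_measurable_continuous_on_indicator[of "{0<..<pi}"] by (simp del: real_scaleR_def)
    have "norm (indicator {0<..<pi} u *\<^sub>R (f (2 * sin u) - f 2)) \<le> norm (g u + g (pi + (-1) * u))" for u
    proof (cases "u \<in> {0<..<pi}")
      case True
      then have "f 2 \<le> f (2 * sin u)"
        by (intro anti) (auto intro: sin_gt_zero)
      moreover have "f (2 * sin u) - f 2 \<le> g u + g (pi - u)"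
        using True bound[of u] bound[of "pi - u"] g_nn[of u] g_nn[of "pi - u"]
        by (cases "u \<le> pi / 2") auto
      ultimately show ?thesis using True by simp
    qed (simp add: g_nn)
    then show "AE u in lborel. norm (indicator {0<..<pi} u *\<^sub>R (f (2 * sin u) - f 2))
        \<le> norm (g u + g (pi + (-1) * u))" by simp
  qed
  then have "set_integrable lborel {0<..<pi} (\<lambda>u. f (2 * sin u) - f 2)"
    by (simp add: set_integrable_def)
  moreover have "set_integrable lborel {0<..<pi} (\<lambda>u. f 2)"
    by (simp add: set_integrable_def)
  ultimately have "set_integrable lborel {0<..<pi} (\<lambda>u. (f (2 * sin u) - f 2) + f 2)"
    by (rule set_integral_add)
  then show ?thesis by simp
qed

text \<open>Substitution \<eta> = 2u: the sine of \<eta>/2 becomes sin u > 0, so the absolute value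
  drops, and the Jacobian gives the factor 2. Integrability survives the cosine factor because it is
  bounded by 1.\<close>

lemma lambda_integrand_double:
  assumes "set_integrable lborel {0<..<pi} (\<lambda>u. K0 (2 * sin u))"
  shows "set_integrable lborel {0<..<pi} (\<lambda>u. K0 (2 * sin u) * cos (2 * real n * u))"
    and "set_integrable lborel {0<..<2 * pi} (lambda_integrand K0 n)"
    and "lambda_coeff K0 n = 2 * (LINT u:{0<..<pi}|lborel. K0 (2 * sin u) * cos (2 * real n * u))"
proof -
  let ?F = "\<lambda>\<eta>. indicator {0<..<2 * pi} \<eta> *\<^sub>R lambda_integrand K0 n \<eta>"
  have F: "?F (0 + 2 * u) = indicator {0<..<pi} u *\<^sub>R (K0 (2 * sin u) * cos (2 * real n * u))" for u
    by (auto simp: lambda_integrand_def indicator_def abs_of_pos sin_gt_zero mult_ac)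
  have int: "integrable lborel (\<lambda>u. indicator {0<..<pi} u *\<^sub>R (K0 (2 * sin u) * cos (2 * real n * u)))"
  proof (rule Bochner_Integration.integrable_bound)
    show "integrable lborel (\<lambda>u. indicator {0<..<pi} u *\<^sub>R K0 (2 * sin u))"
      using assms by (simp add: set_integrable_def)
    then have [measurable]: "(\<lambda>u. indicator {0<..<pi} u *\<^sub>R K0 (2 * sin u)) \<in> borel_measurable lborel"
      by simp
    have "(\<lambda>u. (indicator {0<..<pi} u *\<^sub>R K0 (2 * sin u)) * cos (2 * real n * u)) \<in> borel_measurable lborel"
      by measurable
    then show "(\<lambda>u. indicator {0<..<pi} u *\<^sub>R (K0 (2 * sin u) * cos (2 * real n * u))) \<in> borel_measurable lborel"
      by (simp add: mult.assoc)
  qed (auto simp: abs_mult indicator_def mult_left_le)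
  then show "set_integrable lborel {0<..<pi} (\<lambda>u. K0 (2 * sin u) * cos (2 * real n * u))"
    unfolding set_integrable_def .
  from int show "set_integrable lborel {0<..<2 * pi} (lambda_integrand K0 n)"
    unfolding set_integrable_def
    using lborel_integrable_real_affine_iff[of 2 ?F 0] unfolding F by simp
  have "lambda_coeff K0 n = integral\<^sup>L lborel ?F"
    by (simp add: lambda_coeff_def interval_lebesgue_integral_def set_lebesgue_integral_def)
  also have "\<dots> = \<bar>2\<bar> *\<^sub>R (\<integral>u. ?F (0 + 2 * u) \<partial>lborel)"
    by (rule lborel_integral_real_affine) simp
  finally show "lambda_coeff K0 n = 2 * (LINT u:{0<..<pi}|lborel. K0 (2 * sin u) * cos (2 * real n * u))"
    unfolding F by (simp add: set_lebesgue_integral_def)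
qed

text \<open>Integrability of both integrands is part of the conclusion: a Lebesgue integral that
  does not exist has the default value 0, so the equation alone would not show that the two sides
  are genuine integrals.\<close>

theorem lemma7p9p3:
  fixes K0 :: "real \<Rightarrow> real" and \<mu> :: "real measure" and n :: nat
  assumes "smooth_on_pos K0"
    and "completely_monotone (\<lambda>t. - deriv K0 t)"
    and "\<exists>t>0. - deriv K0 t \<noteq> 0"
    and "radon_measure_on {0..} \<mu>"
    and "\<forall>t>0. has_bochner_integral \<mu> (\<lambda>x. exp (- t * x)) (- deriv K0 t)"
    and "\<exists>\<alpha>::real. 0 < \<alpha> \<and> \<alpha> < 1 \<and>
           interval_lebesgue_integrable lborel (ereal 0) (ereal 1) (\<lambda>t. \<bar>K0 t\<bar> * t powr (- \<alpha>))"
    and "n \<ge> 1"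
  shows "interval_lebesgue_integrable lborel (ereal 0) (ereal (2 * pi)) (lambda_integrand K0 n)
       \<and> integrable \<mu> (phi_quot n)
       \<and> complex_of_real (lambda_coeff K0 n) = 2 * (LINT x|\<mu>. phi_quot n x)
       \<and> (\<forall>x. phi n x =
            complex_of_real (LBINT \<eta>=ereal 0..ereal pi. exp (- 2 * x * sin \<eta>) * cos (2 * real n * \<eta>)))"
proof -

  \<comment> \<open>Monotonicity and integrability of \<open>K0\<close>\<close>
  have sets [measurable_cong]: "sets \<mu> = sets (restrict_space borel {0..})"
    using assms(4) by (simp add: radon_measure_on_def)
  interpret \<mu>: sigma_finite_measure \<mu>
    by (rule sigma_finite_radon_measure_on_Ici[OF assms(4)])
  interpret pair_sigma_finite lborel \<mu> ..
  have id [measurable]: "(\<lambda>x. x) \<in> borel_measurable \<mu>"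
    by (simp add: measurable_cong_sets[OF sets refl] measurable_restrict_space1)
  have deriv: "(K0 has_real_derivative deriv K0 t) (at t)" if "t > 0" for t
    using smooth_on_pos_has_real_derivative[OF assms(1) that] .
  have cont: "continuous_on {0<..} K0"
    using deriv by (auto intro!: DERIV_continuous_on[of _ _ "deriv K0"] dest: has_field_derivative_at_within)
  have nonpos: "deriv K0 t \<le> 0" if "t > 0" for t
  proof -
    have "(-1) ^ 0 * (deriv ^^ 0) (\<lambda>t. - deriv K0 t) t \<ge> 0"
      using assms(2) that unfolding completely_monotone_def by blast
    then show ?thesis by simp
  qed
  have anti: "K0 t \<le> K0 s" if "0 < s" "s \<le> t" for s t
  proof (rule DERIV_nonpos_imp_nonincreasing[OF that(2)])
    fix x assume "s \<le> x"
    with that deriv[of x] nonpos[of x]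
    show "\<exists>y. (K0 has_real_derivative y) (at x) \<and> y \<le> 0" by auto
  qed
  have K0_eq: "has_bochner_integral \<mu> (\<lambda>x. exp_quot x t) (K0 t - K0 2)" if "0 < t" "t \<le> 2" for t
    using has_bochner_integral_exp_quot[OF sets \<mu>.sigma_finite_measure_axioms _ _ that, of K0 "\<lambda>t. - deriv K0 t"]
      deriv assms(5) by simp
  have K0_int: "set_integrable lborel {0<..<1} K0"
  proof -
    obtain \<alpha> :: real where \<alpha>: "0 < \<alpha>"
      and "interval_lebesgue_integrable lborel (ereal 0) (ereal 1) (\<lambda>t. \<bar>K0 t\<bar> * t powr (- \<alpha>))"
      using assms(6) by blast
    then have int: "set_integrable lborel {0<..<1} (\<lambda>t. \<bar>K0 t\<bar> * t powr (- \<alpha>))"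
      by (simp add: interval_lebesgue_integrable_def)
    show ?thesis
    proof (rule set_integrable_bound[OF int])
      show "set_borel_measurable lborel {0<..<1} K0"
        unfolding set_borel_measurable_def
        using borel_measurable_continuous_on_indicator[of "{0<..<1}" K0] continuous_on_subset[OF cont]
        by (auto simp: subset_eq)
      \<comment> \<open>On (0, 1) the weight t^(-\<alpha>) is at least 1, so the weighted integrand
        dominates \<open>K0\<close>.\<close>
      have "norm (K0 t) \<le> norm (\<bar>K0 t\<bar> * t powr (- \<alpha>))" if "t \<in> {0<..<1}" for t
      proof -
        have "1 \<le> t powr (- \<alpha>)"
          using that \<alpha> powr_mono2'[of "-\<alpha>" t 1] by (auto simp: powr_le_one_le)
        then show ?thesis by (simp add: abs_mult mult_le_cancel_left1)
      qed
      then show "AE t in lborel. t \<in> {0<..<1} \<longrightarrow> norm (K0 t) \<le> norm (\<bar>K0 t\<bar> * t powr (- \<alpha>))"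
        by simp
    qed
  qed
  have sin_int: "set_integrable lborel {0<..<pi} (\<lambda>u. K0 (2 * sin u))"
    by (rule integrable_decreasing_comp_sin) (use cont anti K0_int in auto)
  note double = lambda_integrand_double[OF sin_int, of n]

  \<comment> \<open>Exchange of the integrals over u and x\<close>
  define h where "h u x = indicator {0<..<pi} u * (exp_quot x (2 * sin u) * cos (2 * real n * u))"
    for u x :: real
  have sin_range: "0 < 2 * sin u" "2 * sin u \<le> 2" if "u \<in> {0<..<pi}" for u
    using that by (auto intro: sin_gt_zero)
  have h_eq: "has_bochner_integral \<mu> (h u)
      (indicator {0<..<pi} u * ((K0 (2 * sin u) - K0 2) * cos (2 * real n * u)))" for u
  proof (cases "u \<in> {0<..<pi}")
    case True
    then show ?thesis
      unfolding h_def using sin_range[OF True]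
      by (auto intro!: has_bochner_integral_mult_left K0_eq)
  next
    case False
    then have "h u = (\<lambda>x. 0)" by (auto simp: h_def)
    with False show ?thesis by (simp add: has_bochner_integral_zero)
  qed
  \<comment> \<open>As the kernel is non-negative for 2 sin u \<le> 2, only the cosine needs an
    absolute value. The inner integral is thus explicit, and \<open>diff_int\<close> bounds it for
    Fubini.\<close>
  have h_abs: "(LINT x|\<mu>. norm (h u x))
      = indicator {0<..<pi} u * (K0 (2 * sin u) - K0 2) * \<bar>cos (2 * real n * u)\<bar>" for u
  proof (cases "u \<in> {0<..<pi}")
    case True
    then have "norm (h u x) = exp_quot x (2 * sin u) * \<bar>cos (2 * real n * u)\<bar>" for x
      using sin_range[OF True] exp_quot_nonneg[of "2 * sin u" x] by (simp add: h_def abs_mult)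
    then show ?thesis
      using True K0_eq[OF sin_range[OF True]] by (simp add: has_bochner_integral_iff)
  qed (simp add: h_def)
  have diff_int: "integrable lborel (\<lambda>u. indicator {0<..<pi} u * (K0 (2 * sin u) - K0 2))"
    using set_integral_diff(1)[OF sin_int, of "\<lambda>_. K0 2"] by (simp add: set_integrable_def)
  have h_int: "integrable (lborel \<Otimes>\<^sub>M \<mu>) (case_prod h)"
  proof (rule Fubini_integrable)
    show "case_prod h \<in> borel_measurable (lborel \<Otimes>\<^sub>M \<mu>)"
      unfolding h_def by measurable
    show "integrable lborel (\<lambda>u. LINT x|\<mu>. norm (case_prod h (u, x)))"
      unfolding prod.case h_abs
      by (rule Bochner_Integration.integrable_bound[OF diff_int])
         (use diff_int[THEN borel_measurable_integrable] in \<open>auto simp: abs_mult mult_left_le\<close>)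
    show "AE u in lborel. integrable \<mu> (\<lambda>x. case_prod h (u, x))"
      using h_eq by (auto simp: has_bochner_integral_iff)
  qed
  have h_phi: "phi_quot n x = complex_of_real (\<integral>u. h u x \<partial>lborel)" for x
  proof -
    have "continuous_on {0..pi} (\<lambda>u. exp_quot x (2 * sin u) * cos (2 * real n * u))"
      by (cases "x = 0") (auto simp: exp_quot_def intro!: continuous_intros)
    then have int: "set_integrable lborel {0..pi} (\<lambda>u. exp_quot x (2 * sin u) * cos (2 * real n * u))"
      by (rule borel_integrable_atLeastAtMost')
    from interval_integral_eq_integral[of 0 pi, OF _ this] show ?thesis
      by (simp add: phi_quot_eq_integral[OF assms(7)] interval_lebesgue_integral_def
          set_lebesgue_integral_def h_def zero_ereal_def)
  qed
  have phi_int: "integrable \<mu> (phi_quot n)"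
    unfolding h_phi[abs_def] using integrable_snd[OF h_int] by simp
  \<comment> \<open>The constant \<open>K0 2\<close> subtracted inside \<open>h\<close> contributes
    nothing to the cosine coefficient, since n \<ge> 1.\<close>
  have cos_int: "set_integrable lborel {0<..<pi} (\<lambda>u. K0 2 * cos (2 * real n * u))"
    and cos_0: "(LINT u:{0<..<pi}|lborel. K0 2 * cos (2 * real n * u)) = 0"
  proof -
    have int: "set_integrable lborel {0..pi} (\<lambda>u. cos (2 * real n * u))"
      by (intro borel_integrable_atLeastAtMost' continuous_intros)
    then have "set_integrable lborel {0<..<pi} (\<lambda>u. cos (2 * real n * u))"
      by (rule set_integrable_subset) auto
    then show "set_integrable lborel {0<..<pi} (\<lambda>u. K0 2 * cos (2 * real n * u))"
      by simp
    have "(LINT u:{0<..<pi}|lborel. cos (2 * real n * u)) = 0"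
      using interval_integral_eq_integral[of 0 pi, OF _ int]
        integral_unique[OF has_integral_cos_double[OF assms(7)]]
      by (simp add: interval_lebesgue_integral_def zero_ereal_def)
    then show "(LINT u:{0<..<pi}|lborel. K0 2 * cos (2 * real n * u)) = 0"
      by simp
  qed
  have "(LINT x|\<mu>. phi_quot n x) = complex_of_real (\<integral>x. (\<integral>u. h u x \<partial>lborel) \<partial>\<mu>)"
    by (simp add: h_phi)
  also have "(\<integral>x. (\<integral>u. h u x \<partial>lborel) \<partial>\<mu>) = (\<integral>u. (\<integral>x. h u x \<partial>\<mu>) \<partial>lborel)"
    by (rule Fubini_integral[OF h_int])
  also have "\<dots> = (LINT u:{0<..<pi}|lborel. K0 (2 * sin u) * cos (2 * real n * u) - K0 2 * cos (2 * real n * u))"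
    unfolding set_lebesgue_integral_def
    by (intro Bochner_Integration.integral_cong)
       (simp_all add: has_bochner_integral_integral_eq[OF h_eq] left_diff_distrib)
  also have "\<dots> = (LINT u:{0<..<pi}|lborel. K0 (2 * sin u) * cos (2 * real n * u))"
    unfolding set_integral_diff(2)[OF double(1) cos_int] cos_0 by simp
  finally have "complex_of_real (lambda_coeff K0 n) = 2 * (LINT x|\<mu>. phi_quot n x)"
    by (simp add: double(3))
  moreover have "phi n x =
      complex_of_real (LBINT \<eta>=ereal 0..ereal pi. exp (- 2 * x * sin \<eta>) * cos (2 * real n * \<eta>))" for x
  proof -
    have "set_integrable lborel {0..pi} (\<lambda>\<eta>. exp (- 2 * x * sin \<eta>) * cos (2 * real n * \<eta>))"
      by (intro borel_integrable_atLeastAtMost' continuous_intros)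
    from interval_integral_eq_integral[of 0 pi, OF _ this] show ?thesis
      by (simp add: phi_eq_cos_integral zero_ereal_def)
  qed
  ultimately show ?thesis
    using double(2) phi_int by (simp add: interval_lebesgue_integrable_def)
qed

end
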